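(* Let $\Gamma\subset\mathrm{SL}(2,\mathbb{Z})$ be a subgroup of finite index and let $F:\mathbb{H}\to\mathbb{C}$ be a generalized modular form of weight $k$ with multiplier system $v$ on $\Gamma$. Then the function $$u(z):=\mathrm{Im}(z)^{\frac k2}\,F(z)$$ is a generalized Maass wave form: $u\in gM\!\left(\Gamma,k,v,\tfrac k2\left(1-\tfrac k2\right)\right)$.
   Context: $\mathbb{H}=\{z=x+iy\in\mathbb{C}: y>0\}$, on which $\mathrm{SL}(2,\mathbb{R})$ acts by fractional linear transformations. Arguments are normalized by $\arg(w)\in(-\pi,\pi]$ and powers by $w^k=|w|^ke^{ik\arg(w)}$ for $w\neq 0$. For $k\in\mathbb{C}$, $\gamma=\begin{pmatrix}a&b\\c&d\end{pmatrix}\in\mathrm{SL}(2,\mathbb{R})$ and $f:\mathbb{H}\to\mathbb{C}$, put $(f|_k\gamma)(z)=e^{-ik\arg(cz+d)}f(\gamma z)$. A multiplier (system) $v$ on $\Gamma$ compatible with weight $k\in\mathbb{C}$ is a function $v:\Gamma\to\mathbb{C}\setminus\{0\}$ such that $f(\gamma z)=v(\gamma)e^{ik\arg(cz+d)}f(z)$ (for all $\gamma=\begin{pmatrix}a&b\\c&d\end{pmatrix}\in\Gamma$, $z\in\mathbb{H}$) allows non-zero solutions $f$. It is not required to be unitary. $\mathcal{C}_\Gamma$ denotes a (finite) set of representatives of the inequivalent cusps of $\Gamma$. For each $q\in\mathcal{C}_\Gamma$, the stabilizer of $q$ is $\langle\gamma_q,-\mathbf{1}\rangle$, and $g_q\in\mathrm{SL}(2,\mathbb{Z})$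 is a scaling matrix: $q=g_q\,i\infty$ and $g_q^{-1}\gamma_qg_q=\begin{pmatrix}1&l_q\\0&1\end{pmatrix}$, where the positive integer $l_q$ is the width of $q$. A generalized modular form of weight $k$ and multiplier system $v$ (compatible with $k$) on $\Gamma$ is a holomorphic function $F:\mathbb{H}\to\mathbb{C}$ such that $(cz+d)^{-k}F(\gamma z)=v(\gamma)F(z)$ for all $\gamma=\begin{pmatrix}a&b\\c&d\end{pmatrix}\in\Gamma$, $z\in\mathbb{H}$, and such that $F$ has a left-finite Fourier expansion at each cusp: for each $q\in\mathcal{C}_\Gamma$, with $(c,d)$ the bottom row of $g_q$, there are $m\in\mathbb{Z}$, $\kappa_q\in\mathbb{R}$ and $a_n\in\mathbb{C}$ such that $(cz+d)^{-k}F(g_qz)=\sum_{n=-m}^{\infty}a_n\,e^{2\pi i(n+\kappa_q)z/l_q}$ for all $z\in\mathbb{H}$. Laplace operator: $\Delta_k=-y^2(\partial_x^2+\partial_y^2)+iky\,\partial_x$. $gM(\Gamma,k,v,\lambda)$ denotes the space of generalized Maass wave forms of weight $k$, multiplier $v$ and eigenvalue $\lambda\in\mathbb{C}$ for $\Gamma$, i.e. of real-analytic functions $u:\mathbb{H}\to\mathbb{C}$ with (1) $u|_k\gamma=v(\gamma)u$ for all $\gamma\in\Gamma$; (2) $\Delta_ku=\lambda u$; (3) at each cusp $q\in\mathcal{C}_\Gamma$, $u(g_qz)=O(e^{cy})$ as $y\to\infty$ for some $c\in\mathbb{R}$. *)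

theory Defs
  imports
    "HOL-Complex_Analysis.Complex_Analysis"
    "HOL-Algebra.Coset"
    "HOL-Algebra.Generated_Groups"
    "HOL-Library.Landau_Symbols"
begin

text \<open>
  Functions on the upper half plane are represented by functions of type
  \<^typ>\<open>complex \<Rightarrow> complex\<close> whose values off the half plane are irrelevant.
  Elements of the modular group are real matrices with integral entries, so that the same
  action serves \<open>SL(2,\<int>)\<close> and \<open>SL(2,\<real>)\<close>.
\<close>

definition upper_half_plane :: "complex set" where
  "upper_half_plane = {z. Im z > 0}"

definition SL2Z :: "(real^2^2) monoid" where
  "SL2Z = \<lparr>carrier = {A. det A = 1 \<and> (\<forall>i j. A $ i $ j \<in> \<int>)}, mult = (**), one = mat 1\<rparr>"

definition mat_act :: "real^2^2 \<Rightarrow> complex \<Rightarrow> complex" where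
  "mat_act A = moebius (of_real (A$1$1)) (of_real (A$1$2)) (of_real (A$2$1)) (of_real (A$2$2))"

text \<open>The automorphy factor \<open>cz + d\<close>.\<close>

definition aut_den :: "real^2^2 \<Rightarrow> complex \<Rightarrow> complex" where
  "aut_den A z = of_real (A$2$1) * z + of_real (A$2$2)"

text \<open>\<^const>\<open>Arg\<close> takes values in \<open>(-\<pi>,\<pi>]\<close>, and \<open>w powr k = exp (k * Ln w)\<close> with the
  corresponding principal branch.\<close>

definition slash :: "complex \<Rightarrow> real^2^2 \<Rightarrow> (complex \<Rightarrow> complex) \<Rightarrow> complex \<Rightarrow> complex" where
  "slash k A f z = exp (- \<i> * k * of_real (Arg (aut_den A z))) * f (mat_act A z)"

definition multiplier_system :: "(real^2^2) set \<Rightarrow> complex \<Rightarrow> (real^2^2 \<Rightarrow> complex) \<Rightarrow> bool" where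
  "multiplier_system \<Gamma> k v \<longleftrightarrow>
     (\<forall>A\<in>\<Gamma>. v A \<noteq> 0) \<and>
     (\<exists>f :: complex \<Rightarrow> complex.
        (\<exists>z\<in>upper_half_plane. f z \<noteq> 0) \<and>
        (\<forall>A\<in>\<Gamma>. \<forall>z\<in>upper_half_plane.
           f (mat_act A z) = v A * exp (\<i> * k * of_real (Arg (aut_den A z))) * f z))"

datatype bdry = Inf_Pt | Real_Pt real

fun bdry_act :: "real^2^2 \<Rightarrow> bdry \<Rightarrow> bdry" where
  "bdry_act A Inf_Pt = (if A$2$1 = 0 then Inf_Pt else Real_Pt (A$1$1 / A$2$1))"
| "bdry_act A (Real_Pt x) =
     (if A$2$1 * x + A$2$2 = 0 then Inf_Pt
      else Real_Pt ((A$1$1 * x + A$1$2) / (A$2$1 * x + A$2$2)))"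

definition cusps :: "bdry set" where
  "cusps = insert Inf_Pt (Real_Pt ` \<rat>)"

text \<open>
  \<open>C\<close> is a system of representatives of the cusps modulo \<open>\<Gamma>\<close>; for \<open>q \<in> C\<close>, \<open>s q\<close> is the
  generator \<open>\<gamma>\<^sub>q\<close> of the stabilizer, \<open>g q\<close> the scaling matrix and \<open>l q\<close> the width.  The stabilizer
  \<open>\<langle>\<gamma>\<^sub>q, -1\<rangle>\<close> is taken in \<open>\<plusminus>\<Gamma>\<close>, since \<open>\<Gamma>\<close> itself need not contain \<open>-1\<close>;
  if it does, then \<open>\<plusminus>\<Gamma> = \<Gamma>\<close>.
\<close>

definition cusp_system ::
  "(real^2^2) set \<Rightarrow> bdry set \<Rightarrow> (bdry \<Rightarrow> real^2^2) \<Rightarrow> (bdry \<Rightarrow> real^2^2) \<Rightarrow> (bdry \<Rightarrow> nat) \<Rightarrow> bool" where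
  "cusp_system \<Gamma> C s g l \<longleftrightarrow>
     finite C \<and> C \<subseteq> cusps \<and>
     (\<forall>p\<in>cusps. \<exists>!q. q \<in> C \<and> (\<exists>A\<in>\<Gamma>. bdry_act A p = q)) \<and>
     (\<forall>q\<in>C.
        generate SL2Z {s q, - mat 1} = {A \<in> \<Gamma> \<union> uminus ` \<Gamma>. bdry_act A q = q} \<and>
        g q \<in> carrier SL2Z \<and>
        bdry_act (g q) Inf_Pt = q \<and>
        l q > 0 \<and>
        matrix_inv (g q) ** s q ** g q = vector [vector [1, real (l q)], vector [0, 1]])"

definition gen_modular_form ::
  "(real^2^2) set \<Rightarrow> bdry set \<Rightarrow> (bdry \<Rightarrow> real^2^2) \<Rightarrow> (bdry \<Rightarrow> nat) \<Rightarrow>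
   complex \<Rightarrow> (real^2^2 \<Rightarrow> complex) \<Rightarrow> (complex \<Rightarrow> complex) \<Rightarrow> bool" where
  "gen_modular_form \<Gamma> C g l k v F \<longleftrightarrow>
     F holomorphic_on upper_half_plane \<and>
     (\<forall>A\<in>\<Gamma>. \<forall>z\<in>upper_half_plane. aut_den A z powr (- k) * F (mat_act A z) = v A * F z) \<and>
     (\<forall>q\<in>C. \<exists>(m :: int) (\<kappa> :: real) (a :: int \<Rightarrow> complex). \<forall>z\<in>upper_half_plane.
        (\<lambda>j. a (int j - m) *
              exp (2 * of_real pi * \<i> * (of_int (int j - m) + of_real \<kappa>) * z / of_nat (l q)))
        sums (aut_den (g q) z powr (- k) * F (mat_act (g q) z)))"

definition real_analytic_on :: "(complex \<Rightarrow> complex) \<Rightarrow> complex set \<Rightarrow> bool" where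
  "real_analytic_on u S \<longleftrightarrow>
     (\<forall>w\<in>S. \<exists>r>0. \<exists>a :: nat \<Rightarrow> nat \<Rightarrow> complex. \<forall>z\<in>ball w r.
        ((\<lambda>(m, n). a m n * of_real ((Re z - Re w) ^ m * (Im z - Im w) ^ n)) has_sum u z) UNIV)"

definition dx :: "(complex \<Rightarrow> complex) \<Rightarrow> complex \<Rightarrow> complex" where
  "dx u z = vector_derivative (\<lambda>t. u (Complex t (Im z))) (at (Re z))"

definition dy :: "(complex \<Rightarrow> complex) \<Rightarrow> complex \<Rightarrow> complex" where
  "dy u z = vector_derivative (\<lambda>t. u (Complex (Re z) t)) (at (Im z))"

definition Laplace :: "complex \<Rightarrow> (complex \<Rightarrow> complex) \<Rightarrow> complex \<Rightarrow> complex" where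
  "Laplace k u z =
     - of_real ((Im z)\<^sup>2) * (dx (dx u) z + dy (dy u) z) + \<i> * k * of_real (Im z) * dx u z"

text \<open>
  Along the filter \<^term>\<open>filtercomap Im at_top\<close> the imaginary part tends to infinity while the
  real part is unrestricted, so the growth condition is uniform in \<open>x\<close>.
\<close>

definition gM ::
  "(real^2^2) set \<Rightarrow> bdry set \<Rightarrow> (bdry \<Rightarrow> real^2^2) \<Rightarrow>
   complex \<Rightarrow> (real^2^2 \<Rightarrow> complex) \<Rightarrow> complex \<Rightarrow> (complex \<Rightarrow> complex) set" where
  "gM \<Gamma> C g k v ev = {u.
     real_analytic_on u upper_half_plane \<and>
     (\<forall>A\<in>\<Gamma>. \<forall>z\<in>upper_half_plane. slash k A u z = v A * u z) \<and>
     (\<forall>z\<in>upper_half_plane. Laplace k u z = ev * u z) \<and>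
     (\<forall>q\<in>C. \<exists>c :: real. (\<lambda>z. u (mat_act (g q) z))
        \<in> O[filtercomap Im at_top](\<lambda>z. of_real (exp (c * Im z))))}"

lemma group_SL2Z: "group SL2Z"
proof (rule groupI)
  fix A assume A: "A \<in> carrier SL2Z"
  define B :: "real^2^2" where "B = vector [vector [A$2$2, - A$1$2], vector [- A$2$1, A$1$1]]"
  have "B ** A = mat 1"
    using A by (auto simp: SL2Z_def B_def vec_eq_iff forall_2 matrix_matrix_mult_def sum_2 mat_def
        det_2 algebra_simps)
  moreover have "B \<in> carrier SL2Z"
    using A by (auto simp: SL2Z_def B_def forall_2 det_2 algebra_simps)
  ultimately show "\<exists>B\<in>carrier SL2Z. B \<otimes>\<^bsub>SL2Z\<^esub> A = \<one>\<^bsub>SL2Z\<^esub>"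
    by (auto simp: SL2Z_def)
next
  fix A B assume "A \<in> carrier SL2Z" "B \<in> carrier SL2Z"
  moreover from this have "det (A ** B) = 1"
    by (simp add: SL2Z_def det_mul)
  ultimately show "A \<otimes>\<^bsub>SL2Z\<^esub> B \<in> carrier SL2Z"
    by (simp add: SL2Z_def) (simp add: matrix_matrix_mult_def sum_2)
next
  show "\<one>\<^bsub>SL2Z\<^esub> \<in> carrier SL2Z"
    by (simp add: SL2Z_def) (simp add: mat_def)
qed (simp_all add: SL2Z_def matrix_mul_assoc)

end

theory Submission
  imports Defs
begin

text \<open>
  Write \<open>u = y\<^sup>s F\<close> with \<open>s = k/2\<close>. The four conditions on a Maass form come from four
  unrelated facts.

  \<^item> Transformation law. For \<open>det A = 1\<close> one has \<open>Im (A z) = y / \<bar>cz + d\<bar>\<^sup>2\<close>, so \<open>y\<^sup>s\<close> contributes the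
    factor \<open>\<bar>cz + d\<bar>\<close> to the power \<open>- k\<close>. Together with the argument factor in the slash
    operator it is exactly the principal power \<open>(cz + d)\<close> to the \<open>- k\<close>
    (\<open>slash_powr_Im_times\<close>).

  \<^item> Eigenvalue equation. On \<open>y\<^sup>s F\<close> with \<open>F\<close> holomorphic the derivative by \<open>x\<close> acts as \<open>F \<mapsto> F'\<close>
    and the derivative by \<open>y\<close> as \<open>s y\<^sup>-\<^sup>1 + \<i> d/dz\<close>. The second derivatives \<open>F''\<close> cancel because \<open>F\<close> is harmonic,
    the terms with \<open>F'\<close> cancel against the first order term of the weighted Laplacian precisely
    because \<open>2 s = k\<close>, and \<open>- s (s - 1) = s (1 - s)\<close> remains (\<open>Laplace_powr_Im_times\<close>).

  \<^item> Real analyticity. Both factors are holomorphic functions of a complex linear form in \<open>x\<close> and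
    \<open>y\<close>, namely of \<open>y\<close> and of \<open>x + \<i> y\<close>. The binomial theorem turns a Taylor series in
    such a form into an absolutely convergent double series
    (\<open>real_analytic_on_holomorphic_linear_form\<close>), and such series can be multiplied
    (\<open>real_analytic_on_mult\<close>).

  \<^item> Growth. Up to an exponential factor, the Fourier expansion at a cusp is a power series in
    \<open>e\<close> to the \<open>2 \<pi> \<i> z / l\<close>. It converges absolutely for \<open>y = 1\<close>, and this one convergent
    series bounds the expansion for all \<open>y \<ge> 1\<close>, uniformly in \<open>x\<close> (\<open>fourier_series_bound\<close>).
    Passing from \<open>(cz + d)\<close> to the \<open>- k\<close> times \<open>F\<close> back to \<open>u\<close> costs only a bounded factor and a
    power of \<open>y\<close> (\<open>powr_Im_times_mat_act_bigo\<close>).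
\<close>

definition powr_Im_times :: "complex \<Rightarrow> (complex \<Rightarrow> complex) \<Rightarrow> complex \<Rightarrow> complex" where
  "powr_Im_times s G z = of_real (Im z) powr s * G z"

lemma open_upper_half_plane: "open upper_half_plane"
  unfolding upper_half_plane_def by (rule open_halfspace_Im_gt)

section \<open>Real analyticity\<close>

lemma has_sum_product_complex:
  fixes f :: "'a \<Rightarrow> complex" and g :: "'b \<Rightarrow> complex"
  assumes f: "(f has_sum S) A" and g: "(g has_sum T) B"
  shows "((\<lambda>(x, y). f x * g y) has_sum (S * T)) (A \<times> B)"
proof (rule has_sum_SigmaI)
  show "((\<lambda>y. case (x, y) of (x, y) \<Rightarrow> f x * g y) has_sum (f x * T)) B" for x
    using has_sum_cmult_right[OF g] by simp
  show "((\<lambda>x. f x * T) has_sum (S * T)) A"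
    by (rule has_sum_cmult_left[OF f])
  have "(\<lambda>x. norm (f x)) summable_on A" "(\<lambda>y. norm (g y)) summable_on B"
    using f g summable_on_iff_abs_summable_on_complex by (auto simp: summable_on_def)
  then have "(\<lambda>p. norm (case p of (x, y) \<Rightarrow> f x * g y)) summable_on A \<times> B"
    by (auto simp: Infinite_Sum.abs_summable_on_Sigma_iff norm_mult infsum_cmult_right'
        abs_mult infsum_nonneg intro: summable_on_cmult_left summable_on_cmult_right)
  then show "(\<lambda>(x, y). f x * g y) summable_on A \<times> B"
    by (rule abs_summable_summable)
qed

text \<open>
  Cauchy products in two variables. Convergence over an index set is unconditional, so the product
  of the two double series may be summed over all pairs of monomials in any grouping.
\<close>

lemma real_analytic_on_mult:
  assumes "real_analytic_on u S" and "real_analytic_on v S"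
  shows "real_analytic_on (\<lambda>z. u z * v z) S"
  unfolding real_analytic_on_def
proof
  fix w assume "w \<in> S"
  from assms(1)[unfolded real_analytic_on_def, rule_format, OF this] obtain r a where
    "r > 0" and a: "\<And>z. z \<in> ball w r \<Longrightarrow>
      ((\<lambda>(m, n). a m n * of_real ((Re z - Re w) ^ m * (Im z - Im w) ^ n)) has_sum u z) UNIV"
    by blast
  from assms(2)[unfolded real_analytic_on_def, rule_format, OF \<open>w \<in> S\<close>] obtain r' b where
    "r' > 0" and b: "\<And>z. z \<in> ball w r' \<Longrightarrow>
      ((\<lambda>(m, n). b m n * of_real ((Re z - Re w) ^ m * (Im z - Im w) ^ n)) has_sum v z) UNIV"
    by blast
  define c where "c m n = (\<Sum>(i, j)\<in>{..m} \<times> {..n}. a i j * b (m - i) (n - j))" for m n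
  have "((\<lambda>(m, n). c m n * of_real ((Re z - Re w) ^ m * (Im z - Im w) ^ n))
          has_sum (u z * v z)) UNIV" if z: "z \<in> ball w (min r r')" for z
  proof -
    define h t where "h = Re z - Re w" and "t = Im z - Im w"
    define f where "f = (\<lambda>((i, j), (p, q)).
      a i j * of_real (h ^ i * t ^ j) * (b p q * of_real (h ^ p * t ^ q)))"
    define e where "e = (\<lambda>((m, n), (i, j)).
      a i j * b (m - i) (n - j) * of_real (h ^ m * t ^ n))"
    have "(f has_sum (u z * v z)) (UNIV \<times> UNIV)"
      using has_sum_product_complex[OF a b] z
      unfolding f_def h_def t_def by (simp add: case_prod_unfold)
    also have "?this \<longleftrightarrow>
      (e has_sum (u z * v z)) (SIGMA (m, n) : UNIV. {..m} \<times> {..n})"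
      \<comment> \<open>Pairs of monomials are grouped by their product.\<close>
    proof (rule has_sum_reindex_bij_witness[of _
          "\<lambda>((m, n), (i, j)). ((i, j), (m - i, n - j))"
          "\<lambda>((i, j), (p, q)). ((i + p, j + q), (i, j))"])
      show "e ((\<lambda>((i, j), (p, q)). ((i + p, j + q), (i, j))) x) = f x" for x
        by (auto simp: e_def f_def power_add split: prod.splits)
    qed auto
    finally have "((\<lambda>(m, n). \<Sum>x\<in>{..m} \<times> {..n}. e ((m, n), x)) has_sum (u z * v z)) UNIV"
      by (rule has_sum_SigmaD) (auto intro!: has_sum_finiteI)
    moreover have "(\<Sum>x\<in>{..m} \<times> {..n}. e ((m, n), x)) = c m n * of_real (h ^ m * t ^ n)" for m n
      by (simp add: c_def e_def sum_distrib_right case_prod_unfold)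
    ultimately show ?thesis
      by (simp add: h_def t_def)
  qed
  then show "\<exists>r>0. \<exists>a. \<forall>z\<in>ball w r.
      ((\<lambda>(m, n). a m n * of_real ((Re z - Re w) ^ m * (Im z - Im w) ^ n))
        has_sum (u z * v z)) UNIV"
    using \<open>r > 0\<close> \<open>r' > 0\<close> by (intro exI[of _ "min r r'"] conjI exI[of _ c] ballI) auto
qed

text \<open>
  Convergence at \<open>\<bar>h\<bar> + \<bar>t\<bar>\<close>, and not merely at \<open>\<bar>h + t\<bar>\<close>, is what makes the expanded series
  unconditionally summable: the norms of the monomials of \<open>(h + t)\<^sup>n\<close> add up to
  \<open>(\<bar>h\<bar> + \<bar>t\<bar>)\<^sup>n\<close>.
\<close>

lemma has_sum_binomial_expansion:
  fixes c :: "nat \<Rightarrow> complex"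
  assumes sums: "(\<lambda>n. c n * (h + t) ^ n) sums S"
    and summable: "summable (\<lambda>n. norm (c n) * (norm h + norm t) ^ n)"
  shows "((\<lambda>(m, n). c (m + n) * of_nat (m + n choose m) * h ^ m * t ^ n) has_sum S) UNIV"
proof -
  define f where "f = (\<lambda>(n, m). c n * of_nat (n choose m) * h ^ m * t ^ (n - m))"
  have "(f has_sum S) (SIGMA n : UNIV. {..n})"
  proof (rule has_sum_SigmaI)
    show "((\<lambda>m. f (n, m)) has_sum (c n * (h + t) ^ n)) {..n}" for n
      by (rule has_sum_finiteI) (simp_all add: f_def binomial_ring sum_distrib_left mult.assoc)
    have "summable (\<lambda>n. norm (c n * (h + t) ^ n))"
      by (rule summable_comparison_test[OF _ summable])
        (auto simp: norm_mult norm_power intro!: mult_left_mono power_mono norm_triangle_ineq)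
    then show "((\<lambda>n. c n * (h + t) ^ n) has_sum S) UNIV"
      by (rule norm_summable_imp_has_sum[OF _ sums])
    have "(\<Sum>m\<le>n. norm (f (n, m))) = norm (c n) * (norm h + norm t) ^ n" for n
      by (simp add: f_def norm_mult norm_power binomial_ring sum_distrib_left mult.assoc)
    then have "(\<lambda>p. norm (f p)) summable_on (SIGMA n : UNIV. {..n})"
      using summable by (auto simp: Infinite_Sum.abs_summable_on_Sigma_iff intro!: norm_summable_imp_summable_on)
    then show "f summable_on (SIGMA n : UNIV. {..n})"
      by (rule abs_summable_summable)
  qed
  also have "?this \<longleftrightarrow> ?thesis"
    by (rule has_sum_reindex_bij_witness[of _ "\<lambda>(m, n). (m + n, m)" "\<lambda>(n, m). (m, n - m)"])
      (auto simp: f_def)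
  finally show ?thesis .
qed

text \<open>
  The coefficients \<open>\<alpha>\<close> and \<open>\<beta>\<close> are complex, so that \<open>\<alpha> = 1\<close>, \<open>\<beta> = \<i>\<close> gives holomorphic functions of
  \<open>z\<close>, and \<open>\<alpha> = 0\<close>, \<open>\<beta> = 1\<close> gives functions of the imaginary part alone.
\<close>

lemma real_analytic_on_holomorphic_linear_form:
  assumes "open T" and "f holomorphic_on T"
    and maps: "\<And>z. z \<in> S \<Longrightarrow> \<alpha> * of_real (Re z) + \<beta> * of_real (Im z) \<in> T"
  shows "real_analytic_on (\<lambda>z. f (\<alpha> * of_real (Re z) + \<beta> * of_real (Im z))) S"
  unfolding real_analytic_on_def
proof
  fix w assume "w \<in> S"
  define w' where "w' = \<alpha> * of_real (Re w) + \<beta> * of_real (Im w)"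
  obtain R where "R > 0" and R: "ball w' R \<subseteq> T"
    using \<open>open T\<close> maps[OF \<open>w \<in> S\<close>] by (auto simp: w'_def open_contains_ball)
  have hol: "f holomorphic_on ball w' R"
    using assms(2) R by (rule holomorphic_on_subset)
  define c where "c n = (deriv ^^ n) f w' / fact n" for n
  have c: "(\<lambda>n. c n * (x - w') ^ n) sums f x" if "x \<in> ball w' R" for x
    unfolding c_def by (rule holomorphic_power_series[OF hol that])
  have abs: "summable (\<lambda>n. norm (c n) * x ^ n)" if "0 \<le> x" "x < R" for x
  proof -
    obtain x' where "x < x'" "x' < R" using dense[OF \<open>x < R\<close>] by blast
    then have "summable (\<lambda>n. c n * of_real x' ^ n)"
      using c[of "w' + of_real x'"] \<open>0 \<le> x\<close> by (auto simp: dist_norm sums_iff)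
    then have "summable (\<lambda>n. norm (c n * of_real x ^ n))"
      by (rule powser_insidea) (use \<open>0 \<le> x\<close> \<open>x < x'\<close> in auto)
    then show ?thesis using \<open>0 \<le> x\<close> by (simp add: norm_mult norm_power)
  qed
  \<comment> \<open>For \<open>z\<close> in the ball of radius \<open>r\<close> the two increments satisfy \<open>\<bar>h\<bar> + \<bar>t\<bar> < R\<close>; the summand
    \<open>1\<close> covers the case \<open>\<alpha> = \<beta> = 0\<close>.\<close>
  define r where "r = R / (norm \<alpha> + norm \<beta> + 1)"
  have "norm \<alpha> + norm \<beta> + 1 > 0" by (smt (verit) norm_ge_zero)
  then have "r > 0" using \<open>R > 0\<close> by (simp add: r_def)
  define a where "a m n = c (m + n) * of_nat (m + n choose m) * \<alpha> ^ m * \<beta> ^ n" for m n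
  have "((\<lambda>(m, n). a m n * of_real ((Re z - Re w) ^ m * (Im z - Im w) ^ n)) has_sum
          f (\<alpha> * of_real (Re z) + \<beta> * of_real (Im z))) UNIV" if z: "z \<in> ball w r" for z
  proof -
    define h t where "h = \<alpha> * of_real (Re z - Re w)" and "t = \<beta> * of_real (Im z - Im w)"
    have z': "\<alpha> * of_real (Re z) + \<beta> * of_real (Im z) = w' + (h + t)"
      by (simp add: w'_def h_def t_def algebra_simps)
    have "\<bar>Re z - Re w\<bar> \<le> dist w z" "\<bar>Im z - Im w\<bar> \<le> dist w z"
      using abs_Re_le_cmod[of "z - w"] abs_Im_le_cmod[of "z - w"]
      by (simp_all add: dist_norm norm_minus_commute)
    then have "norm h + norm t \<le> norm \<alpha> * dist w z + norm \<beta> * dist w z"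
      by (auto simp: h_def t_def norm_mult simp del: of_real_diff intro!: add_mono mult_left_mono)
    also have "\<dots> \<le> (norm \<alpha> + norm \<beta> + 1) * dist w z"
      by (simp add: algebra_simps)
    also have "\<dots> < R"
      using z \<open>norm \<alpha> + norm \<beta> + 1 > 0\<close> by (simp add: r_def pos_less_divide_eq mult.commute)
    finally have ht: "norm h + norm t < R" .
    then have "w' + (h + t) \<in> ball w' R"
      using norm_triangle_ineq[of h t] by (simp add: dist_norm norm_minus_commute[of "- h" t] add.commute)
    then have "(\<lambda>n. c n * (h + t) ^ n) sums f (w' + (h + t))"
      using c by fastforce
    then have "((\<lambda>(m, n). c (m + n) * of_nat (m + n choose m) * h ^ m * t ^ n)
        has_sum f (w' + (h + t))) UNIV"
      using abs[OF _ ht] by (intro has_sum_binomial_expansion) auto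
    then show ?thesis
      unfolding z' by (simp add: a_def h_def t_def power_mult_distrib mult_ac case_prod_unfold)
  qed
  then show "\<exists>r>0. \<exists>a. \<forall>z\<in>ball w r.
      ((\<lambda>(m, n). a m n * of_real ((Re z - Re w) ^ m * (Im z - Im w) ^ n)) has_sum
        f (\<alpha> * of_real (Re z) + \<beta> * of_real (Im z))) UNIV"
    using \<open>r > 0\<close> by blast
qed

lemma real_analytic_on_powr_Im_times:
  assumes "G holomorphic_on upper_half_plane"
  shows "real_analytic_on (powr_Im_times s G) upper_half_plane"
proof -
  have "real_analytic_on (\<lambda>z. (0 * of_real (Re z) + 1 * of_real (Im z)) powr s) upper_half_plane"
    by (rule real_analytic_on_holomorphic_linear_form[where T = "{z. Re z > 0}"])
      (auto simp: upper_half_plane_def open_halfspace_Re_gt complex_nonpos_Reals_iff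
        intro!: holomorphic_intros)
  moreover have "real_analytic_on (\<lambda>z. G (1 * of_real (Re z) + \<i> * of_real (Im z))) upper_half_plane"
    by (rule real_analytic_on_holomorphic_linear_form[OF open_upper_half_plane assms])
      (simp add: upper_half_plane_def)
  moreover have "1 * of_real (Re z) + \<i> * of_real (Im z) = z" for z
    by (simp add: complex_eq_iff)
  ultimately show ?thesis
    unfolding powr_Im_times_def[abs_def] using real_analytic_on_mult by simp
qed

section \<open>The Laplace operator\<close>

lemma dx_powr_Im_times:
  assumes G: "G holomorphic_on upper_half_plane" and z: "z \<in> upper_half_plane"
  shows "dx (powr_Im_times s G) z = powr_Im_times s (deriv G) z"
proof -
  have "(G has_field_derivative deriv G z) (at z)"
    using holomorphic_derivI[OF G open_upper_half_plane z] .
  moreover have "((\<lambda>t. Complex t (Im z)) has_vector_derivative 1) (at (Re z))"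
    unfolding Complex_eq by (auto intro!: derivative_eq_intros)
  ultimately have "((\<lambda>t. G (Complex t (Im z))) has_vector_derivative deriv G z) (at (Re z))"
    using field_vector_diff_chain_at[of "\<lambda>t. Complex t (Im z)" 1 "Re z" G "deriv G z"]
    by (simp add: o_def)
  then show ?thesis
    unfolding dx_def powr_Im_times_def complex.sel
    by (intro vector_derivative_at has_vector_derivative_mult_right)
qed

text \<open>
  The class of functions \<open>y\<^sup>s G\<close> is closed under the derivative by \<open>x\<close>, and its linear span under the
  derivative by \<open>y\<close>. Hence second derivatives need no further computation.
\<close>

lemma has_vector_derivative_powr_Im_times_vertical:
  assumes G: "G holomorphic_on upper_half_plane" and z: "z \<in> upper_half_plane"
  shows "((\<lambda>t. powr_Im_times s G (Complex (Re z) t)) has_vector_derivative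
    s * powr_Im_times (s - 1) G z + \<i> * powr_Im_times s (deriv G) z) (at (Im z))"
proof -
  have "(G has_field_derivative deriv G z) (at z)"
    using holomorphic_derivI[OF G open_upper_half_plane z] .
  moreover have "((\<lambda>t. Complex (Re z) t) has_vector_derivative \<i>) (at (Im z))"
    unfolding Complex_eq by (auto intro!: derivative_eq_intros)
  ultimately have G': "((\<lambda>t. G (Complex (Re z) t)) has_vector_derivative \<i> * deriv G z) (at (Im z))"
    using field_vector_diff_chain_at[of "\<lambda>t. Complex (Re z) t" \<i> "Im z" G "deriv G z"]
    by (simp add: o_def)
  have "Im z > 0" using z by (simp add: upper_half_plane_def)
  then have "((\<lambda>w. w powr s) has_field_derivative s * of_real (Im z) powr (s - 1)) (at (of_real (Im z)))"
    by (intro has_field_derivative_powr) (auto simp: complex_nonpos_Reals_iff)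
  then have "((\<lambda>t. of_real t powr s) has_vector_derivative s * of_real (Im z) powr (s - 1)) (at (Im z))"
    by (rule has_vector_derivative_real_field)
  from has_vector_derivative_mult[OF this G'] show ?thesis
    unfolding powr_Im_times_def complex.sel by (simp add: algebra_simps)
qed

lemma dy_powr_Im_times:
  assumes "G holomorphic_on upper_half_plane" and "z \<in> upper_half_plane"
  shows "dy (powr_Im_times s G) z =
    s * powr_Im_times (s - 1) G z + \<i> * powr_Im_times s (deriv G) z"
  unfolding dy_def
  by (rule vector_derivative_at[OF has_vector_derivative_powr_Im_times_vertical[OF assms]])

lemma dx_cong:
  assumes "\<And>w. w \<in> upper_half_plane \<Longrightarrow> f w = g w" and "z \<in> upper_half_plane"
  shows "dx f z = dx g z"
  unfolding dx_def using assms by (simp add: upper_half_plane_def)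

lemma dy_cong:
  assumes "\<And>w. w \<in> upper_half_plane \<Longrightarrow> f w = g w" and "z \<in> upper_half_plane"
  shows "dy f z = dy g z"
proof -
  have "\<forall>\<^sub>F t in nhds (Im z). t \<in> {0<..}"
    using assms(2) by (intro eventually_nhds_in_open) (auto simp: upper_half_plane_def)
  then have "\<forall>\<^sub>F t in nhds (Im z). t \<in> UNIV \<longrightarrow> f (Complex (Re z) t) = g (Complex (Re z) t)"
    by eventually_elim (auto intro!: assms(1) simp: upper_half_plane_def)
  then show ?thesis
    unfolding dy_def by (intro vector_derivative_cong_eq) (use assms(2) in auto)
qed

lemma Laplace_powr_Im_times:
  assumes F: "F holomorphic_on upper_half_plane" and z: "z \<in> upper_half_plane"
  shows "Laplace k (powr_Im_times (k / 2) F) z = k / 2 * (1 - k / 2) * powr_Im_times (k / 2) F z"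
proof -
  let ?H = upper_half_plane
  let ?u = "powr_Im_times (k / 2) F"
  have F': "deriv F holomorphic_on ?H"
    using F open_upper_half_plane by (rule holomorphic_deriv)
  define y where "y = complex_of_real (Im z)"
  have y: "y \<noteq> 0" using z by (auto simp: y_def upper_half_plane_def)
  have dxx: "dx (dx ?u) z = powr_Im_times (k / 2) (deriv (deriv F)) z"
    using dx_cong[OF dx_powr_Im_times[OF F] z] dx_powr_Im_times[OF F' z] by simp
  have "dy (dy ?u) z = dy (\<lambda>w. k / 2 * powr_Im_times (k / 2 - 1) F w
      + \<i> * powr_Im_times (k / 2) (deriv F) w) z"
    by (rule dy_cong[OF dy_powr_Im_times[OF F] z])
  also have "\<dots> = k / 2 * ((k / 2 - 1) * powr_Im_times (k / 2 - 1 - 1) F z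
        + \<i> * powr_Im_times (k / 2 - 1) (deriv F) z)
      + \<i> * (k / 2 * powr_Im_times (k / 2 - 1) (deriv F) z
        + \<i> * powr_Im_times (k / 2) (deriv (deriv F)) z)"
    unfolding dy_def
    by (rule vector_derivative_at[OF has_vector_derivative_add[OF
            has_vector_derivative_mult_right has_vector_derivative_mult_right]];
        rule has_vector_derivative_powr_Im_times_vertical[OF _ z], fact)
  finally have dyy: "dy (dy ?u) z = \<dots>" .
  have p1: "y powr (k / 2 - 1) = y powr (k / 2) / y"
    and p2: "y powr (k / 2 - 1 - 1) = y powr (k / 2) / y / y"
    using y by (simp_all add: powr_diff power2_eq_square)
  show ?thesis
    unfolding Laplace_def dxx dyy dx_powr_Im_times[OF F z]
    unfolding powr_Im_times_def y_def[symmetric] p1 p2 of_real_power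
    using y by (simp add: field_simps power2_eq_square)
qed

section \<open>Weight-k invariance\<close>

lemma aut_den_nonzero:
  assumes "det A = 1" and "z \<in> upper_half_plane"
  shows "aut_den A z \<noteq> 0"
proof
  assume "aut_den A z = 0"
  then have "A$2$1 * Im z = 0" "A$2$1 * Re z + A$2$2 = 0"
    by (auto simp: aut_den_def complex_eq_iff)
  with assms show False by (auto simp: upper_half_plane_def det_2)
qed

lemma Im_mat_act:
  assumes "det A = 1"
  shows "Im (mat_act A z) = Im z / (norm (aut_den A z))\<^sup>2"
proof -
  have "Im (mat_act A z) = (A$1$1 * A$2$2 - A$1$2 * A$2$1) * Im z / (norm (aut_den A z))\<^sup>2"
    unfolding mat_act_def moebius_def aut_den_def[symmetric] Im_divide'
    by (simp add: aut_den_def algebra_simps)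
  with assms show ?thesis by (simp add: det_2)
qed

text \<open>
  Since \<open>w powr (- k) = exp (- k (ln \<bar>w\<bar> + \<i> Arg w))\<close> for the principal branch, the slash factor
  supplies the argument and \<open>Im (A z)\<close> the absolute value. The exponent \<open>k\<close> may be any complex number.
\<close>

lemma slash_powr_Im_times:
  assumes A: "det A = 1" and z: "z \<in> upper_half_plane"
  shows "slash k A (powr_Im_times (k / 2) F) z =
    of_real (Im z) powr (k / 2) * (aut_den A z powr (- k) * F (mat_act A z))"
proof -
  define w where "w = aut_den A z"
  have w: "w \<noteq> 0" using aut_den_nonzero[OF A z] by (simp add: w_def)
  have y: "Im z > 0" using z by (simp add: upper_half_plane_def)
  have "of_real (Im (mat_act A z)) powr (k / 2) = exp (k / 2 * of_real (ln (Im z) - 2 * ln (norm w)))"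
    using w y by (simp add: Im_mat_act[OF A] w_def[symmetric] powr_def Ln_of_real ln_div ln_realpow
        del: of_real_divide of_real_power)
  moreover have "of_real (Im z) powr (k / 2) = exp (k / 2 * of_real (ln (Im z)))"
    using y by (simp add: powr_def Ln_of_real)
  moreover have "w powr (- k) = exp (- k * (of_real (ln (norm w)) + \<i> * of_real (Arg w)))"
  proof -
    have "Ln w = of_real (ln (norm w)) + \<i> * of_real (Arg w)"
      using w by (intro complex_eqI) (simp_all add: Arg_eq_Im_Ln)
    then show ?thesis using w by (simp only: powr_def if_False)
  qed
  moreover have "exp (- \<i> * k * of_real (Arg w)) * exp (k / 2 * of_real (ln (Im z) - 2 * ln (norm w))) =
      exp (k / 2 * of_real (ln (Im z))) * exp (- k * (of_real (ln (norm w)) + \<i> * of_real (Arg w)))"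
    unfolding exp_add[symmetric] by (rule arg_cong[where f = exp]) (simp add: algebra_simps)
  ultimately show ?thesis
    unfolding slash_def powr_Im_times_def w_def[symmetric] by (metis mult.assoc)
qed

section \<open>Growth at the cusps\<close>

text \<open>
  Convergence at \<open>z = \<i> / 2\<close> gives absolute convergence at the larger height \<open>z = \<i>\<close>, whose sum
  of norms serves as \<open>M\<close>. Above that height every power of \<open>exp (2 \<pi> \<i> z / L)\<close> is smaller, whereas the
  factor coming from \<open>\<mu>\<close>, which may be negative, is left in the bound.
\<close>

lemma fourier_series_bound:
  fixes a :: "nat \<Rightarrow> complex" and \<mu> L :: real
  assumes "L > 0"
    and S: "\<And>z. z \<in> upper_half_plane \<Longrightarrow>
      (\<lambda>j. a j * exp (2 * of_real pi * \<i> * (of_nat j + of_real \<mu>) * z / of_real L)) sums S z"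
  obtains M where "\<And>z. Im z \<ge> 1 \<Longrightarrow> norm (S z) \<le> M * exp (- 2 * pi * \<mu> * Im z / L)"
proof -
  define e where "e z = exp (2 * of_real pi * \<i> * z / of_real L)" for z
  define p where "p z = exp (2 * of_real pi * \<i> * of_real \<mu> * z / of_real L)" for z
  have norm_e: "norm (e z) = exp (- 2 * pi * Im z / L)"
    and norm_p: "norm (p z) = exp (- 2 * pi * \<mu> * Im z / L)" for z
    by (simp_all add: e_def p_def mult.assoc Im_divide_of_real)
  have sums: "(\<lambda>j. a j * e z ^ j * p z) sums S z" if "z \<in> upper_half_plane" for z
  proof -
    have "exp (2 * of_real pi * \<i> * (of_nat j + of_real \<mu>) * z / of_real L) = e z ^ j * p z" for j
      unfolding e_def p_def exp_of_nat_mult[symmetric] exp_add[symmetric]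
      by (simp add: field_simps add_divide_distrib)
    then show ?thesis using S[OF that] by (simp add: mult.assoc)
  qed
  have "(\<lambda>j. a j * e (\<i> / 2) ^ j * p (\<i> / 2)) sums S (\<i> / 2)"
    by (rule sums) (simp add: upper_half_plane_def)
  then have "summable (\<lambda>j. a j * e (\<i> / 2) ^ j * p (\<i> / 2) * inverse (p (\<i> / 2)))"
    by (rule summable_mult2[OF sums_summable])
  moreover have "p (\<i> / 2) \<noteq> 0"
    by (simp add: p_def)
  ultimately have "summable (\<lambda>j. a j * e (\<i> / 2) ^ j)"
    by (simp add: mult.assoc)
  then have abs: "summable (\<lambda>j. norm (a j * e \<i> ^ j))"
    by (rule powser_insidea) (use \<open>L > 0\<close> in \<open>simp add: norm_e divide_strict_right_mono\<close>)
  show thesis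
  proof
    fix z assume z: "Im z \<ge> 1"
    have le: "norm (a j * e z ^ j * p z) \<le> norm (a j * e \<i> ^ j) * norm (p z)" for j
      using z \<open>L > 0\<close> unfolding norm_mult norm_power
      by (intro mult_right_mono mult_left_mono power_mono)
        (auto simp: norm_e divide_right_mono)
    have "norm (S z) \<le> (\<Sum>j. norm (a j * e \<i> ^ j) * norm (p z))"
    proof (rule norm_sums_le)
      show "(\<lambda>j. a j * e z ^ j * p z) sums S z"
        by (rule sums) (use z in \<open>simp add: upper_half_plane_def\<close>)
      show "(\<lambda>j. norm (a j * e \<i> ^ j) * norm (p z)) sums (\<Sum>j. norm (a j * e \<i> ^ j) * norm (p z))"
        using abs by (intro summable_sums summable_mult2)
    qed (rule le)
    also have "\<dots> = (\<Sum>j. norm (a j * e \<i> ^ j)) * norm (p z)"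
      using abs by (rule suminf_mult2[symmetric])
    finally show "norm (S z) \<le> (\<Sum>j. norm (a j * e \<i> ^ j)) * exp (- 2 * pi * \<mu> * Im z / L)"
      by (simp only: norm_p)
  qed
qed

text \<open>
  Solving the slash identity for \<open>u (A z)\<close> leaves the factor \<open>exp (\<i> k Arg (cz + d))\<close>. For
  non-real \<open>k\<close> it is not unimodular, but it is bounded because the argument is; the factor
  \<open>y\<close> to the power \<open>Re k / 2\<close> is absorbed by an exponential via \<open>ln y \<le> y\<close>.
\<close>

lemma powr_Im_times_mat_act_bigo:
  assumes A: "det A = 1"
    and bound: "\<And>z. Im z \<ge> 1 \<Longrightarrow>
      norm (aut_den A z powr (- k) * F (mat_act A z)) \<le> M * exp (b * Im z)"
  shows "(\<lambda>z. powr_Im_times (k / 2) F (mat_act A z))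
    \<in> O[filtercomap Im at_top](\<lambda>z. of_real (exp ((\<bar>Re k / 2\<bar> + b) * Im z)))"
proof (rule bigoI)
  have "norm (powr_Im_times (k / 2) F (mat_act A z))
      \<le> exp (\<bar>Im k\<bar> * pi) * M * norm (complex_of_real (exp ((\<bar>Re k / 2\<bar> + b) * Im z)))"
    if z: "Im z \<ge> 1" for z
  proof -
    define \<theta> where "\<theta> = Arg (aut_den A z)"
    define y where "y = Im z"
    have "y \<ge> 1" using z by (simp add: y_def)
    have "z \<in> upper_half_plane" using z by (simp add: upper_half_plane_def)
    from slash_powr_Im_times[OF A this, of k F]
    have "exp (- \<i> * k * of_real \<theta>) * powr_Im_times (k / 2) F (mat_act A z) =
        of_real y powr (k / 2) * (aut_den A z powr (- k) * F (mat_act A z))"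
      by (simp add: slash_def \<theta>_def y_def)
    then have "powr_Im_times (k / 2) F (mat_act A z) = exp (\<i> * k * of_real \<theta>) *
        (of_real y powr (k / 2) * (aut_den A z powr (- k) * F (mat_act A z)))"
      by (metis (no_types, lifting) exp_minus_inverse mult.assoc mult_1 mult_minus_left)
    then have "norm (powr_Im_times (k / 2) F (mat_act A z)) = exp (- Im k * \<theta>) *
        (y powr (Re k / 2) * norm (aut_den A z powr (- k) * F (mat_act A z)))"
      using \<open>y \<ge> 1\<close> by (simp add: norm_mult norm_powr_real_powr)
    also have "\<dots> \<le> exp (\<bar>Im k\<bar> * pi) * (exp (\<bar>Re k / 2\<bar> * y) * (M * exp (b * y)))"
    proof (intro mult_mono)
      have "\<bar>\<theta>\<bar> \<le> pi" using Arg_bounded[of "aut_den A z"] by (auto simp: \<theta>_def)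
      have "- Im k * \<theta> \<le> \<bar>Im k\<bar> * \<bar>\<theta>\<bar>" by (metis abs_ge_self abs_minus abs_mult)
      also have "\<dots> \<le> \<bar>Im k\<bar> * pi" using \<open>\<bar>\<theta>\<bar> \<le> pi\<close> by (intro mult_left_mono) auto
      finally show "exp (- Im k * \<theta>) \<le> exp (\<bar>Im k\<bar> * pi)" by simp
      have "Re k / 2 * ln y \<le> \<bar>Re k / 2\<bar> * y"
        using \<open>y \<ge> 1\<close> ln_le_minus_one[of y] by (intro mult_mono) auto
      then show "y powr (Re k / 2) \<le> exp (\<bar>Re k / 2\<bar> * y)"
        using \<open>y \<ge> 1\<close> by (simp add: powr_def)
      show "norm (aut_den A z powr (- k) * F (mat_act A z)) \<le> M * exp (b * y)"
        using bound[OF z] by (simp add: y_def)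
    qed auto
    also have "\<dots> = exp (\<bar>Im k\<bar> * pi) * M * norm (complex_of_real (exp ((\<bar>Re k / 2\<bar> + b) * Im z)))"
      unfolding y_def norm_of_real distrib_right exp_add by simp
    finally show ?thesis .
  qed
  then show "\<forall>\<^sub>F z in filtercomap Im at_top. norm (powr_Im_times (k / 2) F (mat_act A z))
      \<le> exp (\<bar>Im k\<bar> * pi) * M * norm (complex_of_real (exp ((\<bar>Re k / 2\<bar> + b) * Im z)))"
    by (auto simp: eventually_filtercomap intro!: exI[of _ "\<lambda>y. y \<ge> 1"] eventually_ge_at_top)
qed

section \<open>Modular forms as Maass wave forms\<close>

theorem mainTheorem4:
  fixes \<Gamma> :: "(real^2^2) set"
    and C :: "bdry set"
    and s g :: "bdry \<Rightarrow> real^2^2"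
    and l :: "bdry \<Rightarrow> nat"
    and k :: complex
    and v :: "real^2^2 \<Rightarrow> complex"
    and F :: "complex \<Rightarrow> complex"
  assumes "subgroup \<Gamma> SL2Z"
    and "finite (rcosets\<^bsub>SL2Z\<^esub> \<Gamma>)"
    and "cusp_system \<Gamma> C s g l"
    and "multiplier_system \<Gamma> k v"
    and "gen_modular_form \<Gamma> C g l k v F"
  shows "(\<lambda>z. of_real (Im z) powr (k / 2) * F z) \<in> gM \<Gamma> C g k v (k / 2 * (1 - k / 2))"
proof -
  have hol: "F holomorphic_on upper_half_plane"
    and inv: "\<And>A z. A \<in> \<Gamma> \<Longrightarrow> z \<in> upper_half_plane \<Longrightarrow>
      aut_den A z powr (- k) * F (mat_act A z) = v A * F z"
    using assms(5) by (auto simp: gen_modular_form_def)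
  define u where "u = powr_Im_times (k / 2) F"
  have det: "det A = 1" if "A \<in> carrier SL2Z" for A
    using that by (simp add: SL2Z_def)
  have "real_analytic_on u upper_half_plane"
    unfolding u_def by (rule real_analytic_on_powr_Im_times[OF hol])
  moreover have "slash k A u z = v A * u z" if "A \<in> \<Gamma>" "z \<in> upper_half_plane" for A z
  proof -
    have "det A = 1"
      using that(1) subgroup.subset[OF assms(1)] det by blast
    then show ?thesis
      using slash_powr_Im_times[OF _ that(2)] inv[OF that]
      by (simp add: u_def powr_Im_times_def[of _ _ z])
  qed
  moreover have "Laplace k u z = k / 2 * (1 - k / 2) * u z" if "z \<in> upper_half_plane" for z
    unfolding u_def by (rule Laplace_powr_Im_times[OF hol that])
  moreover have "\<exists>c :: real. (\<lambda>z. u (mat_act (g q) z))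
      \<in> O[filtercomap Im at_top](\<lambda>z. of_real (exp (c * Im z)))" if q: "q \<in> C" for q
  proof -
    have "g q \<in> carrier SL2Z" and "l q > 0"
      using assms(3) q by (auto simp: cusp_system_def)
    obtain m :: int and \<kappa> :: real and a :: "int \<Rightarrow> complex" where
      exp: "\<And>z. z \<in> upper_half_plane \<Longrightarrow> (\<lambda>j. a (int j - m) *
        exp (2 * of_real pi * \<i> * (of_int (int j - m) + of_real \<kappa>) * z / of_nat (l q)))
        sums (aut_den (g q) z powr (- k) * F (mat_act (g q) z))"
      using assms(5) q unfolding gen_modular_form_def by blast
    \<comment> \<open>The sum over \<open>j \<ge> 0\<close> has frequencies \<open>j - m + \<kappa>\<close>; the shift is absorbed into \<open>\<mu> = \<kappa> - m\<close>.\<close>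
    obtain M where "\<And>z. Im z \<ge> 1 \<Longrightarrow> norm (aut_den (g q) z powr (- k) * F (mat_act (g q) z))
        \<le> M * exp (- 2 * pi * (\<kappa> - of_int m) * Im z / real (l q))"
    proof (rule fourier_series_bound)
      show "real (l q) > 0" using \<open>l q > 0\<close> by simp
      show "(\<lambda>j. a (int j - m) * exp (2 * of_real pi * \<i> *
          (of_nat j + of_real (\<kappa> - of_int m)) * z / of_real (real (l q))))
          sums (aut_den (g q) z powr (- k) * F (mat_act (g q) z))" if "z \<in> upper_half_plane" for z
        using exp[OF that] by (simp add: algebra_simps)
    qed blast
    then have "norm (aut_den (g q) z powr (- k) * F (mat_act (g q) z))
        \<le> M * exp (- 2 * pi * (\<kappa> - of_int m) / real (l q) * Im z)" if "Im z \<ge> 1" for z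
      using that by simp
    from powr_Im_times_mat_act_bigo[OF det[OF \<open>g q \<in> carrier SL2Z\<close>] this]
    show ?thesis unfolding u_def by blast
  qed
  ultimately have "u \<in> gM \<Gamma> C g k v (k / 2 * (1 - k / 2))"
    by (simp add: gM_def)
  then show ?thesis
    by (simp add: u_def powr_Im_times_def[abs_def])
qed

end
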